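(* Let $M=(E,\mathcal I)$ be a matroid with given weights $\sigma\in\mathbb R^E_{>0}$. Then $\theta_\sigma(A)<\theta_\sigma(E)$ for every nonempty subset $A\subsetneq E$ if and only if $M$ is strictly $\sigma$-homogeneous and connected.
   Context: All matroids are finite, loopless and of positive rank; $r$ is the rank function and $\mathcal B$ the set of bases. For $A\subseteq E$ put $\sigma(A)=\sum_{e\in A}\sigma(e)$, and for $A$ with $r(A)>0$ put $\theta_\sigma(A)=\sigma(A)/r(A)$. For $\lambda\in\mathbb R^E_{>0}$, let $\mu_\lambda$ be the probability mass function on $\mathcal B$ with $\mu_\lambda(B)$ proportional to $\lambda[B]:=\prod_{e\in B}\lambda(e)$, and let $\eta_\lambda(e):=\sum_{B\in\mathcal B:\,e\in B}\mu_\lambda(B)$ for $e\in E$. $M$ is strictly $\sigma$-homogeneous if there exist $\lambda\in\mathbb R^E_{>0}$ and $k>0$ such that $\eta_\lambda(e)=k\,\sigma(e)$ for all $e\in E$. A set $X\subseteq E$ is a separator of $M$ if every circuit of $M$ is contained in $X$ or in $E-X$; $M$ is connected if its only separators are $\emptyset$ and $E$. *)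

theory Defs
  imports Complex_Main
begin

locale matroid =
  fixes E :: "'a set" and I :: "'a set set"
  assumes finite_ground: "finite E"
    and indep_subset_ground: "X \<in> I \<Longrightarrow> X \<subseteq> E"
    and empty_indep: "{} \<in> I"
    and indep_subset: "X \<in> I \<Longrightarrow> Y \<subseteq> X \<Longrightarrow> Y \<in> I"
    and indep_augment:
      "X \<in> I \<Longrightarrow> Y \<in> I \<Longrightarrow> card X < card Y \<Longrightarrow> \<exists>y\<in>Y - X. insert y X \<in> I"

definition matroid_bases :: "'a set set \<Rightarrow> 'a set set" where
  "matroid_bases I = {B \<in> I. \<forall>X\<in>I. B \<subseteq> X \<longrightarrow> X = B}"

definition matroid_circuits :: "'a set \<Rightarrow> 'a set set \<Rightarrow> 'a set set" where
  "matroid_circuits E I = {C. C \<subseteq> E \<and> C \<notin> I \<and> (\<forall>D. D \<subset> C \<longrightarrow> D \<in> I)}"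

definition matroid_rank :: "'a set set \<Rightarrow> 'a set \<Rightarrow> nat" where
  "matroid_rank I A = Max (card ` {X \<in> I. X \<subseteq> A})"

definition loopless :: "'a set \<Rightarrow> 'a set set \<Rightarrow> bool" where
  "loopless E I \<longleftrightarrow> (\<forall>e\<in>E. {e} \<in> I)"

definition matroid_separator :: "'a set \<Rightarrow> 'a set set \<Rightarrow> 'a set \<Rightarrow> bool" where
  "matroid_separator E I X \<longleftrightarrow>
     X \<subseteq> E \<and> (\<forall>C\<in>matroid_circuits E I. C \<subseteq> X \<or> C \<subseteq> E - X)"

definition matroid_connected :: "'a set \<Rightarrow> 'a set set \<Rightarrow> bool" where
  "matroid_connected E I \<longleftrightarrow> (\<forall>X. matroid_separator E I X \<longrightarrow> X = {} \<or> X = E)"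

text \<open>Only meaningful when \<open>A\<close> has positive rank; in a loopless matroid this holds for
  every nonempty subset \<open>A\<close> of the ground set.\<close>

definition weight_density :: "'a set set \<Rightarrow> ('a \<Rightarrow> real) \<Rightarrow> 'a set \<Rightarrow> real" where
  "weight_density I \<sigma> A = sum \<sigma> A / real (matroid_rank I A)"

text \<open>The mass function on bases with mass proportional to \<open>prod l B\<close>. It is only ever
  evaluated at bases.\<close>

definition basis_mass :: "'a set set \<Rightarrow> ('a \<Rightarrow> real) \<Rightarrow> 'a set \<Rightarrow> real" where
  "basis_mass I l B = prod l B / (\<Sum>B'\<in>matroid_bases I. prod l B')"

definition basis_marginal :: "'a set set \<Rightarrow> ('a \<Rightarrow> real) \<Rightarrow> 'a \<Rightarrow> real" where
  "basis_marginal I l e = (\<Sum>B\<in>{B \<in> matroid_bases I. e \<in> B}. basis_mass I l B)"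

definition strictly_homogeneous :: "'a set \<Rightarrow> 'a set set \<Rightarrow> ('a \<Rightarrow> real) \<Rightarrow> bool" where
  "strictly_homogeneous E I \<sigma> \<longleftrightarrow>
     (\<exists>(l :: 'a \<Rightarrow> real) (k :: real).
        (\<forall>e\<in>E. l e > 0) \<and> k > 0 \<and> (\<forall>e\<in>E. basis_marginal I l e = k * \<sigma> e))"

end

theory Submission
  imports Defs "HOL-Analysis.Function_Topology"
begin

text \<open>
  Write \<open>r\<close> for the rank function and let \<open>x\<close> be the multiple of \<open>\<sigma>\<close> with \<open>x(E) = r(E)\<close>. The
  density condition says \<open>x(A) < r(A)\<close> for all nonempty proper \<open>A\<close>, that is, \<open>x\<close> lies in the
  base polytope and the rank inequalities of all nonempty proper subsets are strict.

  If \<open>\<sigma>\<close> is proportional to the marginals of \<open>\<mu> = \<mu>\<^sub>\<lambda>\<close> with positive \<open>\<lambda>\<close>, then these marginals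
  are \<open>x\<close>, and \<open>x(A)\<close> is the mean of \<open>card (B \<inter> A)\<close>, which is at most \<open>r(A)\<close>. As \<open>\<mu>\<close> charges every
  basis, equality forces all bases to meet \<open>A\<close> in exactly \<open>r(A)\<close> elements. Exchanging one element
  along a circuit that crosses \<open>A\<close> would change this number, so \<open>A\<close> is then a separator
  (\<open>separator_if_bases_tight\<close>), which connectedness excludes.

  In the other direction, the rank is additive over a separator (\<open>rank_separator\<close>), so a
  nontrivial separator and its complement cannot both be less dense than \<open>E\<close>. The substantial
  part is to find \<open>\<lambda>\<close>. With \<open>\<lambda> = exp \<circ> t\<close>, having marginals \<open>x\<close> says that the gradient of
  \<open>G(t) = \<Sum>\<^sub>B exp (t(B) - \<langle>x, t\<rangle>)\<close> vanishes (\<open>marginal_of_minimizer\<close>), so it suffices that \<open>G\<close>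
  has a minimizer. Since all bases have size \<open>x(E)\<close>, \<open>G\<close> is invariant under adding a constant to \<open>t\<close>.
  Modulo this it is coercive: for the basis \<open>J\<close> that the greedy algorithm selects for the
  weights \<open>t\<close>, the slack in the rank inequalities makes \<open>t(J) - \<langle>x, t\<rangle>\<close> grow at least linearly in
  \<open>max t - min t\<close> (\<open>greedy_basis\<close>, \<open>tilted_partition_coercive\<close>). Compactness of a cube
  finishes the argument.
\<close>

section \<open>Rank, bases and separators\<close>

context matroid
begin

lemma finite_indep_sets: "finite I"
  using finite_ground indep_subset_ground
  by (meson Pow_iff finite_Pow_iff finite_subset subsetI)

lemma finite_indep: "X \<in> I \<Longrightarrow> finite X"
  using finite_ground indep_subset_ground finite_subset by metis

lemma card_indep_le_rank: "X \<in> I \<Longrightarrow> X \<subseteq> A \<Longrightarrow> card X \<le> matroid_rank I A"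
  unfolding matroid_rank_def using finite_indep_sets by (intro Max_ge) auto

lemma rank_attained: "\<exists>X\<in>I. X \<subseteq> A \<and> card X = matroid_rank I A"
proof -
  have "matroid_rank I A \<in> card ` {X \<in> I. X \<subseteq> A}"
    unfolding matroid_rank_def using finite_indep_sets empty_indep by (intro Max_in) auto
  then show ?thesis by auto
qed

lemma rank_empty: "matroid_rank I {} = 0"
  using rank_attained[of "{}"] by auto

lemma indep_augment_to_card:
  assumes "X \<in> I" "Y \<in> I" "card X \<le> card Y"
  shows "\<exists>K\<in>I. X \<subseteq> K \<and> K \<subseteq> X \<union> Y \<and> card K = card Y"
  using assms
proof (induction "card Y - card X" arbitrary: X)
  case 0
  then show ?case by (intro bexI[of _ X]) auto
next
  case (Suc n)
  then have "card X < card Y" by linarith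
  then obtain y where y: "y \<in> Y - X" "insert y X \<in> I"
    using indep_augment[of X Y] Suc.prems by blast
  have c: "card (insert y X) = Suc (card X)"
    using y finite_indep Suc.prems by simp
  have "\<exists>K\<in>I. insert y X \<subseteq> K \<and> K \<subseteq> insert y X \<union> Y \<and> card K = card Y"
    using y c Suc.hyps(2) \<open>card X < card Y\<close> Suc.prems by (intro Suc.hyps(1)) auto
  then show ?case using y by blast
qed

lemma indep_extend_to_rank:
  assumes "X \<in> I" "X \<subseteq> A"
  shows "\<exists>K\<in>I. X \<subseteq> K \<and> K \<subseteq> A \<and> card K = matroid_rank I A"
proof -
  obtain Y where Y: "Y \<in> I" "Y \<subseteq> A" "card Y = matroid_rank I A"
    using rank_attained by blast
  then have "card X \<le> card Y" using card_indep_le_rank assms by simp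
  then show ?thesis using indep_augment_to_card[of X Y] assms Y
    by (metis le_sup_iff subset_trans)
qed

lemma bases_eq_indep_card: "matroid_bases I = {B \<in> I. card B = matroid_rank I E}"
proof (intro set_eqI iffI)
  fix B assume "B \<in> matroid_bases I"
  then have B: "B \<in> I" "\<And>X. X \<in> I \<Longrightarrow> B \<subseteq> X \<Longrightarrow> X = B" unfolding matroid_bases_def by auto
  with indep_extend_to_rank[of B E] indep_subset_ground
  show "B \<in> {B \<in> I. card B = matroid_rank I E}" by force
next
  fix B assume B: "B \<in> {B \<in> I. card B = matroid_rank I E}"
  have "X = B" if "X \<in> I" "B \<subseteq> X" for X
    using that B card_indep_le_rank[of X E] indep_subset_ground finite_indep[of X]
    by (metis (mono_tags, lifting) card_seteq mem_Collect_eq)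
  then show "B \<in> matroid_bases I" using B unfolding matroid_bases_def by auto
qed

lemma finite_bases: "finite (matroid_bases I)"
  using finite_indep_sets unfolding matroid_bases_def by auto

lemma basis_subset_ground: "B \<in> matroid_bases I \<Longrightarrow> B \<subseteq> E"
  using indep_subset_ground bases_eq_indep_card by auto

lemma bases_nonempty: "matroid_bases I \<noteq> {}"
  using rank_attained[of E] bases_eq_indep_card by auto

lemma dependent_contains_circuit:
  assumes "S \<subseteq> E" "S \<notin> I"
  shows "\<exists>C\<in>matroid_circuits E I. C \<subseteq> S"
proof -
  let ?D = "{C. C \<subseteq> S \<and> C \<notin> I}"
  have fin: "finite ?D"
    using finite_subset[OF assms(1) finite_ground] by simp
  have "?D \<noteq> {}" using assms(2) by auto
  from finite_has_minimal[OF fin this]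
  obtain C where C: "C \<in> ?D" "\<forall>D\<in>?D. D \<subseteq> C \<longrightarrow> C = D" by (elim bexE)
  have "D \<in> I" if "D \<subset> C" for D
    using C that by auto
  then have "C \<in> matroid_circuits E I"
    unfolding matroid_circuits_def using C(1) assms(1) by auto
  then show ?thesis using C(1) by auto
qed

text \<open>The union of maximal independent subsets of \<open>X\<close> and of \<open>E - X\<close> is independent: a circuit in
  it would lie on one side of the separator, hence inside one of the two independent sets.\<close>

lemma rank_separator:
  assumes "matroid_separator E I X"
  shows "matroid_rank I X + matroid_rank I (E - X) \<le> matroid_rank I E"
proof -
  obtain Y where Y: "Y \<in> I" "Y \<subseteq> X" "card Y = matroid_rank I X"
    using rank_attained by blast
  obtain Z where Z: "Z \<in> I" "Z \<subseteq> E - X" "card Z = matroid_rank I (E - X)"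
    using rank_attained by blast
  have X: "X \<subseteq> E" "\<And>C. C \<in> matroid_circuits E I \<Longrightarrow> C \<subseteq> X \<or> C \<subseteq> E - X"
    using assms unfolding matroid_separator_def by auto
  have "Y \<union> Z \<in> I"
  proof (rule ccontr)
    assume "Y \<union> Z \<notin> I"
    then obtain C where C: "C \<in> matroid_circuits E I" "C \<subseteq> Y \<union> Z"
      using dependent_contains_circuit[of "Y \<union> Z"] Y Z X by blast
    then have "C \<subseteq> Y \<or> C \<subseteq> Z" using X(2)[OF C(1)] Y(2) Z(2) by blast
    then have "C \<in> I" using indep_subset Y Z by blast
    then show False using C unfolding matroid_circuits_def by blast
  qed
  moreover have "card (Y \<union> Z) = card Y + card Z"
    using Y Z finite_indep by (intro card_Un_disjoint) auto
  ultimately show ?thesis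
    using card_indep_le_rank[of "Y \<union> Z" E] indep_subset_ground Y Z by metis
qed

text \<open>A circuit \<open>C\<close> containing \<open>e \<in> A\<close> and \<open>f \<notin> A\<close> gives two bases that differ by exchanging
  \<open>f\<close> for \<open>e\<close>, so that they meet \<open>A\<close> in different numbers of elements.\<close>

lemma separator_if_bases_tight:
  assumes "A \<subseteq> E"
    and tight: "\<And>B. B \<in> matroid_bases I \<Longrightarrow> card (B \<inter> A) = n"
  shows "matroid_separator E I A"
  unfolding matroid_separator_def
proof (intro conjI ballI)
  fix C assume C: "C \<in> matroid_circuits E I"
  show "C \<subseteq> A \<or> C \<subseteq> E - A"
  proof (rule ccontr)
    assume "\<not> ?thesis"
    moreover have CE: "C \<subseteq> E" "C \<notin> I" "\<And>D. D \<subset> C \<Longrightarrow> D \<in> I"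
      using C unfolding matroid_circuits_def by auto
    ultimately obtain e f where e: "e \<in> C" "e \<in> A" and f: "f \<in> C" "f \<notin> A" by blast
    obtain B where B: "B \<in> I" "C - {e} \<subseteq> B" "card B = matroid_rank I E"
      using indep_extend_to_rank[of "C - {e}" E] CE e by blast
    have eB: "e \<notin> B" using B indep_subset CE e by (metis Diff_subset_conv insert_absorb insert_is_Un)
    have Cf: "C - {f} \<in> I" using CE(3) f by blast
    then have "card (C - {f}) \<le> card B"
      using B(3) card_indep_le_rank[OF _ indep_subset_ground] by metis
    then obtain B' where B': "B' \<in> I" "C - {f} \<subseteq> B'" "B' \<subseteq> (C - {f}) \<union> B" "card B' = card B"
      using indep_augment_to_card[OF Cf B(1)] by blast
    have fB': "f \<notin> B'" using B' indep_subset CE f by (metis Diff_subset_conv insert_absorb insert_is_Un)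
    have ef: "e \<noteq> f" "f \<in> B" using e f B by auto
    have "B' \<subseteq> insert e (B - {f})" using B'(3) B(2) fB' by blast
    moreover have "card (insert e (B - {f})) = card B'"
      using B'(4) eB card_Suc_Diff1[OF finite_indep[OF B(1)] ef(2)] finite_indep[OF B(1)]
      by (simp del: card_Diff_singleton card_Diff_insert)
    ultimately have eq: "B' = insert e (B - {f})"
      using finite_indep[OF B(1)] by (intro card_subset_eq) auto
    have "B' \<inter> A = insert e (B \<inter> A)" using eq e f by auto
    then have "card (B' \<inter> A) = Suc (card (B \<inter> A))"
      using eB finite_indep[OF B(1)] by simp
    moreover have "B \<in> matroid_bases I" "B' \<in> matroid_bases I"
      using B B' bases_eq_indep_card by auto
    ultimately show False using tight by simp
  qed
qed fact

section \<open>Weighted averages over bases\<close>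

lemma partition_function_pos:
  assumes "\<And>e. e \<in> E \<Longrightarrow> (l e :: real) > 0"
  shows "(\<Sum>B\<in>matroid_bases I. prod l B) > 0"
  using finite_bases bases_nonempty basis_subset_ground assms
  by (intro sum_pos prod_pos) auto

lemma basis_mass_pos:
  assumes "\<And>e. e \<in> E \<Longrightarrow> (l e :: real) > 0" and "B \<in> matroid_bases I"
  shows "basis_mass I l B > 0"
  unfolding basis_mass_def
  using partition_function_pos[of l] basis_subset_ground assms
  by (intro divide_pos_pos prod_pos) auto

lemma sum_basis_mass:
  assumes "\<And>e. e \<in> E \<Longrightarrow> (l e :: real) > 0"
  shows "(\<Sum>B\<in>matroid_bases I. basis_mass I l B) = 1"
  using partition_function_pos[of l] assms
  unfolding basis_mass_def by (simp flip: sum_divide_distrib)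

lemma sum_basis_marginal:
  assumes "A \<subseteq> E"
  shows "(\<Sum>e\<in>A. basis_marginal I l e)
    = (\<Sum>B\<in>matroid_bases I. basis_mass I l B * card (B \<inter> A))"
proof -
  have fA: "finite A" using assms finite_ground finite_subset by blast
  have "(\<Sum>e\<in>A. basis_marginal I l e)
      = (\<Sum>e\<in>A. \<Sum>B\<in>matroid_bases I. if e \<in> B then basis_mass I l B else 0)"
    unfolding basis_marginal_def
    by (intro sum.cong refl sum.inter_filter finite_bases)
  also have "\<dots> = (\<Sum>B\<in>matroid_bases I. \<Sum>e\<in>A. if e \<in> B then basis_mass I l B else 0)"
    by (rule sum.swap)
  also have "\<dots> = (\<Sum>B\<in>matroid_bases I. basis_mass I l B * card (B \<inter> A))"
    using fA by (intro sum.cong refl) (simp add: sum.If_cases Int_commute mult.commute)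
  finally show ?thesis .
qed

lemma card_basis_Int_le_rank: "B \<in> matroid_bases I \<Longrightarrow> card (B \<inter> A) \<le> matroid_rank I A"
  using card_indep_le_rank[of "B \<inter> A" A] indep_subset bases_eq_indep_card by auto

lemma sum_basis_marginal_ground:
  assumes "\<And>e. e \<in> E \<Longrightarrow> (l e :: real) > 0"
  shows "(\<Sum>e\<in>E. basis_marginal I l e) = matroid_rank I E"
proof -
  have "(\<Sum>e\<in>E. basis_marginal I l e)
      = (\<Sum>B\<in>matroid_bases I. basis_mass I l B * matroid_rank I E)"
    unfolding sum_basis_marginal[OF subset_refl]
  proof (intro sum.cong refl)
    fix B assume B: "B \<in> matroid_bases I"
    then have "B \<inter> E = B" using basis_subset_ground by auto
    then show "basis_mass I l B * card (B \<inter> E) = basis_mass I l B * matroid_rank I E"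
      using B bases_eq_indep_card by auto
  qed
  then show ?thesis using sum_basis_mass[of l] assms by (simp flip: sum_distrib_right)
qed

lemma sum_basis_marginal_less_rank:
  assumes pos: "\<And>e. e \<in> E \<Longrightarrow> (l e :: real) > 0"
    and "A \<subseteq> E" and "\<not> matroid_separator E I A"
  shows "(\<Sum>e\<in>A. basis_marginal I l e) < matroid_rank I A"
proof -
  obtain B where B: "B \<in> matroid_bases I" "card (B \<inter> A) \<noteq> matroid_rank I A"
    using separator_if_bases_tight assms by blast
  then have "card (B \<inter> A) < matroid_rank I A" using card_basis_Int_le_rank[of B A] by simp
  then have "(\<Sum>B\<in>matroid_bases I. basis_mass I l B * card (B \<inter> A))
      < (\<Sum>B\<in>matroid_bases I. basis_mass I l B * matroid_rank I A)"
    using B basis_mass_pos[OF pos] card_basis_Int_le_rank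
    by (intro sum_strict_mono_ex1 finite_bases) (auto intro!: mult_left_mono less_imp_le)
  then show ?thesis
    using sum_basis_marginal[OF \<open>A \<subseteq> E\<close>] sum_basis_mass[OF pos] by (simp flip: sum_distrib_right)
qed

section \<open>Coercivity from the greedy algorithm\<close>

text \<open>
  The basis is built by adding elements in the order of decreasing weight \<open>t\<close>. When an element
  \<open>a\<close> of least weight is added, measuring weights relative to \<open>t a\<close> makes its own contribution
  vanish on both sides; lowering the reference level to \<open>m\<close> then adds \<open>t a - m\<close> times
  \<open>y(A)\<close> on the left and \<open>t a - m\<close> times \<open>r(A)\<close> on the right. The last premise allows \<open>y\<close> to
  violate the rank inequality for \<open>A\<close> itself, if the level is not lowered in the last
  step.
\<close>

lemma greedy_basis:
  fixes t y :: "'a \<Rightarrow> real"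
  assumes "A \<subseteq> E"
    and "\<And>C. C \<subset> A \<Longrightarrow> sum y C \<le> matroid_rank I C"
    and "\<And>e. e \<in> A \<Longrightarrow> m \<le> t e"
    and "sum y A \<le> matroid_rank I A \<or> m \<in> t ` A"
  shows "\<exists>J\<in>I. J \<subseteq> A \<and> card J = matroid_rank I A \<and>
           (\<Sum>e\<in>A. y e * (t e - m)) \<le> (\<Sum>e\<in>J. t e - m)"
  using assms
proof (induction "card A" arbitrary: A m rule: less_induct)
  case less
  have fA: "finite A" using less.prems finite_ground finite_subset by blast
  show ?case
  proof (cases "A = {}")
    case True
    then show ?thesis using empty_indep rank_empty by auto
  next
    case False
    obtain a where a: "a \<in> A" "\<And>e. e \<in> A \<Longrightarrow> t a \<le> t e"
      using fA False by (metis arg_min_if_finite(1) arg_min_least)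
    have sub: "A - {a} \<subset> A" using a by auto
    then have "card (A - {a}) < card A" using fA by (rule psubset_card_mono[rotated])
    have "\<exists>J\<in>I. J \<subseteq> A - {a} \<and> card J = matroid_rank I (A - {a}) \<and>
           (\<Sum>e\<in>A - {a}. y e * (t e - t a)) \<le> (\<Sum>e\<in>J. t e - t a)"
    proof (rule less.hyps)
      show "card (A - {a}) < card A" by fact
      show "sum y C \<le> matroid_rank I C" if "C \<subset> A - {a}" for C
        using that less.prems(2)[of C] by blast
      show "sum y (A - {a}) \<le> matroid_rank I (A - {a}) \<or> t a \<in> t ` (A - {a})"
        using less.prems(2)[OF sub] by simp
    qed (use less.prems(1) a in auto)
    then obtain J' where J': "J' \<in> I" "J' \<subseteq> A - {a}"
      "(\<Sum>e\<in>A - {a}. y e * (t e - t a)) \<le> (\<Sum>e\<in>J'. t e - t a)" by blast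
    obtain J where J: "J \<in> I" "J' \<subseteq> J" "J \<subseteq> A" "card J = matroid_rank I A"
      using indep_extend_to_rank[of J' A] J' by blast
    have "m \<le> t a" using less.prems(3) a by blast
    then have shift: "(t a - m) * sum y A \<le> (t a - m) * matroid_rank I A"
      using less.prems(4) a(2) by (auto intro: mult_left_mono) (smt (verit) mult_eq_0_iff)
    have "(\<Sum>e\<in>A. y e * (t e - m))
        = (\<Sum>e\<in>A. y e * (t e - t a)) + (t a - m) * sum y A"
      by (simp add: sum_distrib_left sum.distrib[symmetric] algebra_simps)
    also have "(\<Sum>e\<in>A. y e * (t e - t a)) = (\<Sum>e\<in>A - {a}. y e * (t e - t a))"
      using a fA by (simp add: sum.remove)
    also have "\<dots> \<le> (\<Sum>e\<in>J'. t e - t a)" by fact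
    also have "\<dots> \<le> (\<Sum>e\<in>J. t e - t a)"
      using J a finite_indep by (intro sum_mono2) auto
    finally have "(\<Sum>e\<in>A. y e * (t e - m))
        \<le> (\<Sum>e\<in>J. t e - t a) + (t a - m) * matroid_rank I A"
      using shift by linarith
    also have "\<dots> = (\<Sum>e\<in>J. t e - m)"
      using J(4) by (simp add: sum_subtractf algebra_simps)
    finally show ?thesis using J by blast
  qed
qed

end

text \<open>In the exponential coordinates \<open>\<lambda> = exp \<circ> t\<close> this is the normalizing sum
  \<open>\<Sum>\<^sub>B \<lambda>[B]\<close> divided by \<open>exp \<langle>x, t\<rangle>\<close>; its logarithm is the dual objective of maximizing entropy
  among the distributions on the bases with marginals \<open>x\<close>.\<close>

definition tilted_partition :: "'a set \<Rightarrow> 'a set set \<Rightarrow> ('a \<Rightarrow> real) \<Rightarrow> ('a \<Rightarrow> real) \<Rightarrow> real" where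
  "tilted_partition E I x t = (\<Sum>B\<in>matroid_bases I. exp (sum t B - (\<Sum>e\<in>E. x e * t e)))"

lemma continuous_tilted_partition: "continuous_on S (tilted_partition E I x)"
proof -
  have "continuous_on S (\<lambda>t::'a \<Rightarrow> real. t e)" for e
    by (rule continuous_on_subset[OF continuous_on_product_coordinates]) simp
  then show ?thesis unfolding tilted_partition_def by (intro continuous_intros)
qed

lemma compact_cube: "compact {t :: 'b \<Rightarrow> real. \<forall>e. t e \<in> {u..v}}"
proof -
  have "compactin (product_topology (\<lambda>_. euclidean) UNIV) (PiE (UNIV :: 'b set) (\<lambda>_. {u..v}))"
    unfolding compactin_PiE by (simp add: compact_Icc)
  moreover have "PiE (UNIV :: 'b set) (\<lambda>_. {u..v}) = {t. \<forall>e. t e \<in> {u..v}}" by auto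
  ultimately show ?thesis
    by (simp add: euclidean_product_topology)
qed

context matroid
begin

lemma tilted_partition_shift:
  assumes "sum x E = real (matroid_rank I E)"
    and eq: "\<And>e. e \<in> E \<Longrightarrow> t' e = t e - m"
  shows "tilted_partition E I x t' = tilted_partition E I x t"
  unfolding tilted_partition_def
proof (intro sum.cong refl)
  fix B assume B: "B \<in> matroid_bases I"
  have "sum t' B = (\<Sum>e\<in>B. t e - m)"
    using eq basis_subset_ground[OF B] by (intro sum.cong) auto
  also have "\<dots> = sum t B - m * matroid_rank I E"
    using B bases_eq_indep_card by (auto simp: sum_subtractf)
  finally have 1: "sum t' B = sum t B - m * matroid_rank I E" .
  have "(\<Sum>e\<in>E. x e * t' e) = (\<Sum>e\<in>E. x e * t e - m * x e)"
    by (intro sum.cong refl) (simp add: eq algebra_simps)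
  also have "\<dots> = (\<Sum>e\<in>E. x e * t e) - m * matroid_rank I E"
    using assms by (simp add: sum_subtractf flip: sum_distrib_left)
  finally show "exp (sum t' B - (\<Sum>e\<in>E. x e * t' e)) = exp (sum t B - (\<Sum>e\<in>E. x e * t e))"
    using 1 by simp
qed

text \<open>The slack \<open>\<delta>\<close> permits raising \<open>x\<close> by \<open>\<delta>\<close> at the single element \<open>b\<close> without violating a rank
  inequality of a proper subset; the greedy inequality for this larger vector carries the
  additional term \<open>\<delta> * (t b - t a)\<close>.\<close>

lemma tilted_partition_coercive:
  assumes xE: "sum x E = real (matroid_rank I E)" and "\<delta> \<ge> 0"
    and slack: "\<And>A. A \<noteq> {} \<Longrightarrow> A \<subset> E \<Longrightarrow> sum x A + \<delta> \<le> matroid_rank I A"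
    and a: "a \<in> E" "\<And>e. e \<in> E \<Longrightarrow> t a \<le> t e" and b: "b \<in> E"
  shows "exp (\<delta> * (t b - t a)) \<le> tilted_partition E I x t"
proof -
  define y where "y = (\<lambda>e. x e + (if e = b then \<delta> else 0))"
  have sum_y: "sum y C = sum x C + (if b \<in> C then \<delta> else 0)" if "C \<subseteq> E" for C
    using that finite_ground finite_subset[of C E] unfolding y_def by (simp add: sum.distrib)
  have "sum y C \<le> matroid_rank I C" if "C \<subset> E" for C
    using that slack[of C] sum_y[of C] rank_empty \<open>\<delta> \<ge> 0\<close> by (cases "C = {}") auto
  then obtain J where J: "J \<in> I" "card J = matroid_rank I E"
      "(\<Sum>e\<in>E. y e * (t e - t a)) \<le> (\<Sum>e\<in>J. t e - t a)"
    using greedy_basis[of E y "t a" t] a by blast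
  have JB: "J \<in> matroid_bases I" using J bases_eq_indep_card by auto
  have "(\<Sum>e\<in>E. y e * (t e - t a))
      = (\<Sum>e\<in>E. x e * t e - t a * x e + (if e = b then \<delta> * (t b - t a) else 0))"
    unfolding y_def by (intro sum.cong) (auto simp: algebra_simps)
  also have "\<dots> = (\<Sum>e\<in>E. x e * t e) - t a * matroid_rank I E + \<delta> * (t b - t a)"
    using b finite_ground xE by (simp add: sum.distrib sum_subtractf flip: sum_distrib_left)
  moreover have "(\<Sum>e\<in>J. t e - t a) = sum t J - t a * matroid_rank I E"
    using J by (simp add: sum_subtractf)
  ultimately have "\<delta> * (t b - t a) \<le> sum t J - (\<Sum>e\<in>E. x e * t e)" using J(3) by linarith
  then have "exp (\<delta> * (t b - t a)) \<le> exp (sum t J - (\<Sum>e\<in>E. x e * t e))" by simp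
  also have "\<dots> \<le> tilted_partition E I x t"
    unfolding tilted_partition_def by (intro member_le_sum JB finite_bases) auto
  finally show ?thesis .
qed

section \<open>The minimizer and its marginals\<close>

text \<open>A \<open>t\<close> with value at most that at \<open>0\<close>, the number of bases, has spread at most
  \<open>ln (card (matroid_bases I)) / \<delta>\<close>; shifting its minimum to \<open>0\<close> moves it into a fixed cube, so
  that a minimizer over the cube is a global one.\<close>

lemma tilted_partition_has_minimizer:
  assumes xE: "sum x E = real (matroid_rank I E)" and "\<delta> > 0" and "E \<noteq> {}"
    and slack: "\<And>A. A \<noteq> {} \<Longrightarrow> A \<subset> E \<Longrightarrow> sum x A + \<delta> \<le> matroid_rank I A"
  shows "\<exists>s. \<forall>t. tilted_partition E I x s \<le> tilted_partition E I x t"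
proof -
  define N where "N = real (card (matroid_bases I))"
  define R where "R = ln N / \<delta>"
  let ?K = "{t :: 'a \<Rightarrow> real. \<forall>e. t e \<in> {0..R}}"
  let ?G = "tilted_partition E I x"
  have "N \<ge> 1" unfolding N_def using finite_bases bases_nonempty
    by (simp add: Suc_leI card_gt_0_iff)
  then have "R \<ge> 0" unfolding R_def using \<open>\<delta> > 0\<close> by simp
  then have zero: "(\<lambda>_. 0) \<in> ?K" by simp
  then have "?K \<noteq> {}" by (metis empty_iff)
  from continuous_attains_inf[OF compact_cube this continuous_tilted_partition[of _ E I x]]
  obtain s where s: "s \<in> ?K" "\<And>t. t \<in> ?K \<Longrightarrow> ?G s \<le> ?G t" by blast
  have "?G s \<le> ?G t" for t
  proof (rule ccontr)
    assume less: "\<not> ?G s \<le> ?G t"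
    have G0: "?G (\<lambda>_. 0) = N" unfolding tilted_partition_def N_def by simp
    with less s(2)[OF zero] have le: "?G t \<le> N" by linarith
    obtain a where a: "a \<in> E" "\<And>e. e \<in> E \<Longrightarrow> t a \<le> t e"
      using finite_ground \<open>E \<noteq> {}\<close> by (metis arg_min_if_finite(1) arg_min_least)
    define t' where "t' = (\<lambda>e. if e \<in> E then t e - t a else 0)"
    have "t e - t a \<le> R" if "e \<in> E" for e
    proof -
      have "exp (\<delta> * (t e - t a)) \<le> ?G t"
        using tilted_partition_coercive[of x \<delta> a t e] xE \<open>\<delta> > 0\<close> slack a that by simp
      then have "exp (\<delta> * (t e - t a)) \<le> N" using le by linarith
      then have "\<delta> * (t e - t a) \<le> ln N" using \<open>N \<ge> 1\<close> by (simp add: ln_ge_iff)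
      then show ?thesis unfolding R_def using \<open>\<delta> > 0\<close> by (simp add: field_simps)
    qed
    then have "t' \<in> ?K" unfolding t'_def using a \<open>R \<ge> 0\<close> by auto
    then have "?G s \<le> ?G t'" by (rule s(2))
    also have "?G t' = ?G t"
      by (rule tilted_partition_shift[OF xE, where m = "t a"]) (simp add: t'_def)
    finally show False using less by simp
  qed
  then show ?thesis by blast
qed

lemma marginal_of_minimizer:
  assumes min: "\<And>t. tilted_partition E I x s \<le> tilted_partition E I x t"
    and e: "e \<in> E"
  shows "basis_marginal I (\<lambda>e. exp (s e)) e = x e"
proof -
  let ?l = "\<lambda>e. exp (s e)"
  define c where "c = (\<Sum>e\<in>E. x e * s e)"
  define d where "d B = (if e \<in> B then 1 else 0) - x e" for B
  define h where "h u = (\<Sum>B\<in>matroid_bases I. exp (sum s B - c + u * d B))" for u :: real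
  have h: "h u = tilted_partition E I x (\<lambda>f. s f + (if f = e then u else 0))" for u
    unfolding h_def tilted_partition_def
  proof (intro sum.cong refl)
    fix B assume "B \<in> matroid_bases I"
    then have "finite B" using bases_eq_indep_card finite_indep by auto
    then have "(\<Sum>f\<in>B. s f + (if f = e then u else 0)) = sum s B + (if e \<in> B then u else 0)"
      by (simp add: sum.distrib)
    moreover have "(\<Sum>f\<in>E. x f * (s f + (if f = e then u else 0)))
        = (\<Sum>f\<in>E. x f * s f + (if f = e then x e * u else 0))"
      by (intro sum.cong) (auto simp: algebra_simps)
    moreover have "\<dots> = c + x e * u"
      using e finite_ground unfolding c_def by (simp add: sum.distrib)
    ultimately show "exp (sum s B - c + u * d B) =
        exp ((\<Sum>f\<in>B. s f + (if f = e then u else 0))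
          - (\<Sum>f\<in>E. x f * (s f + (if f = e then u else 0))))"
      unfolding d_def by (simp add: algebra_simps)
  qed
  have "(h has_real_derivative (\<Sum>B\<in>matroid_bases I. d B * exp (sum s B - c))) (at 0)"
    unfolding h_def by (auto intro!: derivative_eq_intros sum.cong)
  moreover have "h 0 \<le> h u" for u using min unfolding h by simp
  ultimately have "(\<Sum>B\<in>matroid_bases I. d B * exp (sum s B - c)) = 0"
    by (intro DERIV_local_min[of h _ 0 1]) auto
  also have "(\<Sum>B\<in>matroid_bases I. d B * exp (sum s B - c))
      = (\<Sum>B\<in>matroid_bases I. d B * prod ?l B) * exp (- c)"
    unfolding sum_distrib_right
  proof (intro sum.cong refl)
    fix B assume "B \<in> matroid_bases I"
    then have "finite B" using bases_eq_indep_card finite_indep by auto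
    then show "d B * exp (sum s B - c) = d B * prod ?l B * exp (- c)"
      by (simp add: exp_sum exp_diff exp_minus field_simps)
  qed
  finally have "(\<Sum>B\<in>matroid_bases I. d B * prod ?l B) = 0" by simp
  moreover have "(\<Sum>B\<in>matroid_bases I. d B * prod ?l B)
      = (\<Sum>B\<in>matroid_bases I. if e \<in> B then prod ?l B else 0)
        - x e * (\<Sum>B\<in>matroid_bases I. prod ?l B)"
    unfolding d_def sum_distrib_left sum_subtractf[symmetric]
    by (intro sum.cong) (auto simp: algebra_simps)
  ultimately have "(\<Sum>B\<in>{B \<in> matroid_bases I. e \<in> B}. prod ?l B)
      = x e * (\<Sum>B\<in>matroid_bases I. prod ?l B)"
    by (simp add: sum.inter_filter finite_bases)
  then show ?thesis
    using partition_function_pos[of ?l]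
    unfolding basis_marginal_def basis_mass_def by (simp flip: sum_divide_distrib)
qed

lemma prescribed_marginals:
  assumes xE: "sum x E = real (matroid_rank I E)" and "E \<noteq> {}"
    and strict: "\<And>A. A \<noteq> {} \<Longrightarrow> A \<subset> E \<Longrightarrow> sum x A < matroid_rank I A"
  shows "\<exists>l. (\<forall>e\<in>E. l e > 0) \<and> (\<forall>e\<in>E. basis_marginal I l e = x e)"
proof -
  let ?D = "(\<lambda>A. matroid_rank I A - sum x A) ` {A. A \<noteq> {} \<and> A \<subset> E}"
  \<comment> \<open>Inserting \<open>1\<close> covers a one-element ground set, which has no nonempty proper subsets.\<close>
  define \<delta> where "\<delta> = Min (insert 1 ?D)"
  have "finite {A. A \<noteq> {} \<and> A \<subset> E}"
    using finite_ground by (rule_tac finite_subset[of _ "Pow E"]) auto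
  then have fin: "finite (insert 1 ?D)" by simp
  then have "\<delta> > 0" unfolding \<delta>_def using strict by (subst Min_gr_iff) auto
  moreover have "sum x A + \<delta> \<le> matroid_rank I A" if "A \<noteq> {}" "A \<subset> E" for A
  proof -
    have "\<delta> \<le> matroid_rank I A - sum x A"
      unfolding \<delta>_def using fin that by (intro Min_le) auto
    then show ?thesis by simp
  qed
  ultimately obtain s where "\<And>t. tilted_partition E I x s \<le> tilted_partition E I x t"
    using tilted_partition_has_minimizer[OF xE] \<open>E \<noteq> {}\<close> by blast
  then show ?thesis using marginal_of_minimizer[of x s]
    by (intro exI[of _ "\<lambda>e. exp (s e)"]) auto
qed

section \<open>Density and strict homogeneity\<close>

lemma rank_pos:
  assumes "loopless E I" "A \<subseteq> E" "A \<noteq> {}"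
  shows "matroid_rank I A > 0"
proof -
  obtain e where "e \<in> A" using assms by blast
  then show ?thesis
    using assms card_indep_le_rank[of "{e}" A] unfolding loopless_def by auto
qed

end

theorem theorem5p1:
  fixes E :: "'a set" and I :: "'a set set" and \<sigma> :: "'a \<Rightarrow> real"
  assumes "matroid E I"
    and "loopless E I"
    and "matroid_rank I E > 0"
    and "\<And>e. e \<in> E \<Longrightarrow> \<sigma> e > 0"
  shows "(\<forall>A. A \<noteq> {} \<and> A \<subset> E \<longrightarrow> weight_density I \<sigma> A < weight_density I \<sigma> E)
     \<longleftrightarrow> strictly_homogeneous E I \<sigma> \<and> matroid_connected E I"
proof -
  interpret matroid E I by fact
  have "E \<noteq> {}" using assms(3) rank_empty by auto
  then have \<sigma>E: "sum \<sigma> E > 0" using finite_ground assms(4) by (intro sum_pos) auto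
  define k where "k = matroid_rank I E / sum \<sigma> E"
  have "k > 0" unfolding k_def using \<sigma>E assms(3) by simp
  have k\<sigma>E: "k * sum \<sigma> E = matroid_rank I E" unfolding k_def using \<sigma>E by simp
  have density_iff: "weight_density I \<sigma> A < weight_density I \<sigma> E
      \<longleftrightarrow> k * sum \<sigma> A < matroid_rank I A" if "A \<noteq> {}" "A \<subset> E" for A
  proof -
    have "matroid_rank I A > 0" using rank_pos assms(2) that by blast
    then show ?thesis
      unfolding weight_density_def k_def using assms(3) \<sigma>E by (simp add: field_simps)
  qed
  show ?thesis
  proof (intro iffI conjI)
    assume "\<forall>A. A \<noteq> {} \<and> A \<subset> E \<longrightarrow> weight_density I \<sigma> A < weight_density I \<sigma> E"
    then have strict: "k * sum \<sigma> A < matroid_rank I A" if "A \<noteq> {}" "A \<subset> E" for A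
      using density_iff that by blast
    have "\<exists>l. (\<forall>e\<in>E. l e > 0) \<and> (\<forall>e\<in>E. basis_marginal I l e = k * \<sigma> e)"
      using k\<sigma>E \<open>E \<noteq> {}\<close> strict
      by (intro prescribed_marginals) (simp_all flip: sum_distrib_left)
    then show "strictly_homogeneous E I \<sigma>"
      unfolding strictly_homogeneous_def using \<open>k > 0\<close> by blast
    show "matroid_connected E I"
      unfolding matroid_connected_def
    proof (intro allI impI, rule ccontr)
      fix X assume X: "matroid_separator E I X" and "\<not> (X = {} \<or> X = E)"
      then have XE: "X \<noteq> {}" "X \<subset> E" "E - X \<noteq> {}" "E - X \<subset> E"
        unfolding matroid_separator_def by auto
      have "k * sum \<sigma> E = k * sum \<sigma> X + k * sum \<sigma> (E - X)"
        using XE finite_ground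
        by (metis add.commute distrib_left psubset_imp_subset sum.subset_diff)
      then show False
        using strict[OF XE(1,2)] strict[OF XE(3,4)] rank_separator[OF X] k\<sigma>E by linarith
    qed
  next
    assume hyp: "strictly_homogeneous E I \<sigma> \<and> matroid_connected E I"
    then obtain l k' where l: "\<And>e. e \<in> E \<Longrightarrow> l e > 0"
        and marg: "\<And>e. e \<in> E \<Longrightarrow> basis_marginal I l e = k' * \<sigma> e"
      unfolding strictly_homogeneous_def by blast
    have sum_marg: "(\<Sum>e\<in>A. basis_marginal I l e) = k' * sum \<sigma> A" if "A \<subseteq> E" for A
      using marg that by (simp add: sum_distrib_left subset_iff)
    have "k' * sum \<sigma> E = k * sum \<sigma> E"
      using sum_basis_marginal_ground[of l] l sum_marg[of E] k\<sigma>E by simp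
    then have "k' = k" using \<sigma>E by simp
    show "\<forall>A. A \<noteq> {} \<and> A \<subset> E \<longrightarrow> weight_density I \<sigma> A < weight_density I \<sigma> E"
    proof (intro allI impI)
      fix A assume A: "A \<noteq> {} \<and> A \<subset> E"
      then have "\<not> matroid_separator E I A"
        using hyp unfolding matroid_connected_def by blast
      then have "k * sum \<sigma> A < matroid_rank I A"
        using sum_basis_marginal_less_rank[of l A] l sum_marg[of A] A \<open>k' = k\<close> by auto
      then show "weight_density I \<sigma> A < weight_density I \<sigma> E" using density_iff A by blast
    qed
  qed
qed

end
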